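(* Let $\varrho>0$, let $g:\mathbb{R}^n\to(-\infty,\infty]$ be a $\varrho$-weakly convex function, and let $\{x^k\}$, $\{\varepsilon_k\}$, $\{r_k\}$ be sequences generated by the inexact proximal point method (described in the context) applied to $g$. If $\|x^k\|\not\to\infty$ as $k\to\infty$, then the following assertions hold: (i) $\varepsilon_k\downarrow 0$ and $r_k\downarrow 0$ as $k\to\infty$. (ii) Every accumulation point of $\{x^k\}$ is a stationary point of $g$. (iii) If the sequence $\{x^k\}$ is bounded, then the set of accumulation points of $\{x^k\}$ is nonempty, compact, and connected. (iv) If $\{x^k\}$ has an isolated accumulation point, then the entire sequence $\{x^k\}$ converges to it.
   Context: $\mathbb{R}^n$ carries the Euclidean norm; $\mathbb{N}=\{1,2,\ldots\}$. A proper lower semicontinuous function $g:\mathbb{R}^n\to(-\infty,\infty]$ is $\varrho$-weakly convex ($\varrho\ge0$) if $g(\cdot)+\frac{\varrho}{2}\|\cdot\|^2$ is convex. For $\lambda\in(0,\varrho^{-1})$ (with $0^{-1}:=\infty$), the proximal mapping $\mathrm{Prox}_{\lambda g}(x):=\operatorname{argmin}_{y\in\mathbb{R}^n}\{g(y)+\frac{1}{2\lambda}\|y-x\|^2\}$ is single-valued on $\mathbb{R}^n$. Stationary point: $\bar x$ with $0\in\partial g(\bar x)$, where $\partial g$ is the limiting (Mordukhovich) subdifferential; for weakly convex $g$ it coincides with the regular (Fréchet) subdifferential $\{v:\liminf_{x\to\bar x}\frac{g(x)-g(\bar x)-\langle v,x-\bar x\rangle}{\|x-\bar x\|}\ge0\}$,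 $\bar x\in\operatorname{dom} g$. Inexact proximal point method. Parameters: $\lambda\in(0,\varrho^{-1})$, $0<\tau_1\le\tau_2<2\lambda$, $x^1\in\mathbb{R}^n$, $\varepsilon_1,r_1>0$, $\mu,\theta\in(0,1)$. For each $k\in\mathbb{N}$: - choose any $p^k\in\mathbb{R}^n$ with $\|p^k-\mathrm{Prox}_{\lambda g}(x^k)\|\le\lambda\varepsilon_k$ and put $g^k:=\lambda^{-1}(x^k-p^k)$; - if $\|g^k\|\le r_k+\varepsilon_k$, set $r_{k+1}:=\mu r_k$, $\varepsilon_{k+1}:=\theta\varepsilon_k$, $d^k:=0$; otherwise set $r_{k+1}:=r_k$, $\varepsilon_{k+1}:=\varepsilon_k$, $d^k:=-\frac{\|g^k\|-\varepsilon_k}{\|g^k\|}g^k$; - choose any $t_k\in[\tau_1,\tau_2]$ and set $x^{k+1}:=x^k+t_kd^k$. A sequence is generated by the method if it arises from some admissible choice of all parameters, $p^k$ and $t_k$. *)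

theory Defs
  imports "HOL-Analysis.Analysis"
begin

text \<open>Functions into \<open>(-\<infinity>, \<infinity>]\<close> are rendered as \<open>ereal\<close>-valued functions that omit the value
  \<open>-\<infinity>\<close>; this is part of properness.\<close>

definition proper_fun :: "('a \<Rightarrow> ereal) \<Rightarrow> bool" where
  "proper_fun g \<longleftrightarrow> (\<forall>x. g x \<noteq> -\<infinity>) \<and> (\<exists>x. g x \<noteq> \<infinity>)"

definition lsc_fun :: "('a::topological_space \<Rightarrow> ereal) \<Rightarrow> bool" where
  "lsc_fun g \<longleftrightarrow> (\<forall>x. g x \<le> Liminf (at x) g)"

text \<open>\<open>convex_on\<close> of the library is restricted to real-valued functions. The sums below never have
  the form \<open>\<infinity> - \<infinity>\<close> when \<open>f\<close> omits \<open>-\<infinity>\<close>.\<close>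

definition ereal_convex :: "('a::real_vector \<Rightarrow> ereal) \<Rightarrow> bool" where
  "ereal_convex f \<longleftrightarrow>
    (\<forall>x y. \<forall>u\<in>{0<..<1}. f ((1 - u) *\<^sub>R x + u *\<^sub>R y) \<le> ereal (1 - u) * f x + ereal u * f y)"

definition weakly_convex :: "real \<Rightarrow> ('a::euclidean_space \<Rightarrow> ereal) \<Rightarrow> bool" where
  "weakly_convex \<rho> g \<longleftrightarrow> \<rho> \<ge> 0 \<and> proper_fun g \<and> lsc_fun g \<and>
    ereal_convex (\<lambda>x. g x + ereal (\<rho> / 2 * (norm x)\<^sup>2))"

definition Prox_set :: "real \<Rightarrow> ('a::euclidean_space \<Rightarrow> ereal) \<Rightarrow> 'a \<Rightarrow> 'a set" where
  "Prox_set lam g x =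
    {y. is_arg_min (\<lambda>y. g y + ereal (1 / (2 * lam) * (norm (y - x))\<^sup>2)) (\<lambda>_. True) y}"

text \<open>Meaningful where \<open>Prox_set\<close> is a singleton, which is the case for \<open>\<rho>\<close>-weakly convex \<open>g\<close> and
  \<open>0 < lam < 1 / \<rho>\<close>.\<close>

definition Prox :: "real \<Rightarrow> ('a::euclidean_space \<Rightarrow> ereal) \<Rightarrow> 'a \<Rightarrow> 'a" where
  "Prox lam g x = the_elem (Prox_set lam g x)"

definition regular_subdifferential :: "('a::euclidean_space \<Rightarrow> ereal) \<Rightarrow> 'a \<Rightarrow> 'a set" where
  "regular_subdifferential g a =
    {v. \<bar>g a\<bar> \<noteq> \<infinity> \<and>
        Liminf (at a) (\<lambda>x. (g x - g a - ereal (v \<bullet> (x - a))) / ereal (norm (x - a))) \<ge> 0}"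

text \<open>The limiting (Mordukhovich) subdifferential: limits of regular subgradients along
  \<open>g\<close>-attentive convergence of the base points.\<close>

definition limiting_subdifferential :: "('a::euclidean_space \<Rightarrow> ereal) \<Rightarrow> 'a \<Rightarrow> 'a set" where
  "limiting_subdifferential g a =
    {v. \<bar>g a\<bar> \<noteq> \<infinity> \<and>
        (\<exists>y w. y \<longlonglongrightarrow> a \<and> (\<lambda>k. g (y k)) \<longlonglongrightarrow> g a \<and>
               (\<forall>k. w k \<in> regular_subdifferential g (y k)) \<and> w \<longlonglongrightarrow> v)}"

definition stationary_point :: "('a::euclidean_space \<Rightarrow> ereal) \<Rightarrow> 'a \<Rightarrow> bool" where
  "stationary_point g a \<longleftrightarrow> 0 \<in> limiting_subdifferential g a"

definition accumulation_points :: "(nat \<Rightarrow> 'a::topological_space) \<Rightarrow> 'a set" where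
  "accumulation_points x = {a. \<exists>s. strict_mono s \<and> (x \<circ> s) \<longlonglongrightarrow> a}"

text \<open>One iteration of the inexact proximal point method, from \<open>(x, \<epsilon>, r)\<close> to \<open>(x', \<epsilon>', r')\<close>, with
  approximate proximal point \<open>p\<close> and stepsize \<open>t\<close>.\<close>

definition ippm_step ::
  "('a::euclidean_space \<Rightarrow> ereal) \<Rightarrow> real \<Rightarrow> real \<Rightarrow> real \<Rightarrow> real \<Rightarrow> real \<Rightarrow> 'a \<Rightarrow> real \<Rightarrow>
    'a \<Rightarrow> real \<Rightarrow> real \<Rightarrow> 'a \<Rightarrow> real \<Rightarrow> real \<Rightarrow> bool" where
  "ippm_step g lam \<tau>1 \<tau>2 \<mu> \<theta> p t x \<epsilon> r x' \<epsilon>' r' \<longleftrightarrow>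
    norm (p - Prox lam g x) \<le> lam * \<epsilon> \<and> t \<in> {\<tau>1..\<tau>2} \<and>
    (let v = inverse lam *\<^sub>R (x - p);
         null = (norm v \<le> r + \<epsilon>);
         d = (if null then 0 else - ((norm v - \<epsilon>) / norm v) *\<^sub>R v)
     in r' = (if null then \<mu> * r else r) \<and>
        \<epsilon>' = (if null then \<theta> * \<epsilon> else \<epsilon>) \<and>
        x' = x + t *\<^sub>R d)"

text \<open>The sequences are indexed from 1; their values at index 0 are irrelevant. In \<open>ereal\<close>, the
  inverse of 0 is \<open>\<infinity>\<close>.\<close>

definition ippm_generated ::
  "real \<Rightarrow> ('a::euclidean_space \<Rightarrow> ereal) \<Rightarrow> (nat \<Rightarrow> 'a) \<Rightarrow> (nat \<Rightarrow> real) \<Rightarrow> (nat \<Rightarrow> real) \<Rightarrow> bool"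
where
  "ippm_generated \<rho> g x \<epsilon> r \<longleftrightarrow>
    (\<exists>lam \<tau>1 \<tau>2 \<mu> \<theta> p t.
      0 < lam \<and> ereal lam < inverse (ereal \<rho>) \<and>
      0 < \<tau>1 \<and> \<tau>1 \<le> \<tau>2 \<and> \<tau>2 < 2 * lam \<and>
      \<epsilon> 1 > 0 \<and> r 1 > 0 \<and> \<mu> \<in> {0<..<1} \<and> \<theta> \<in> {0<..<1} \<and>
      (\<forall>k\<ge>1. ippm_step g lam \<tau>1 \<tau>2 \<mu> \<theta> (p k) (t k)
               (x k) (\<epsilon> k) (r k) (x (Suc k)) (\<epsilon> (Suc k)) (r (Suc k))))"

end

theory Submission
  imports Defs
begin

text \<open>The method is an inexact gradient method on the Moreau envelope \<open>e\<close> of \<open>g\<close>, whose gradient at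
  \<open>x\<close> is \<open>(x - Prox x) / lam\<close>. Shortening \<open>g\<^sup>k\<close> by \<open>\<epsilon>\<^sub>k\<close> compensates the error of the approximate
  proximal point, so that \<open>e (x\<^sup>k\<^sup>+\<^sup>1) \<le> e (x\<^sup>k) - c \<parallel>x\<^sup>k\<^sup>+\<^sup>1 - x\<^sup>k\<parallel>\<^sup>2\<close> with \<open>c > 0\<close>. If \<open>\<parallel>x\<^sup>k\<parallel>\<close> does not tend to
  infinity, \<open>e\<close> is bounded below along a subsequence, hence along all iterates, and the steps
  tend to 0. A step that is not null has length at least \<open>\<tau>1 r\<^sub>k\<close>, so null steps occur infinitely
  often, which forces \<open>\<epsilon>\<^sub>k, r\<^sub>k \<rightarrow> 0\<close> and then \<open>x\<^sup>k - Prox (x\<^sup>k) \<rightarrow> 0\<close>. By lower semicontinuity every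
  accumulation point is a fixed point of the proximal mapping, and therefore stationary. The
  topological assertions are Ostrowski's consequences of the vanishing of the steps.\<close>

subsection \<open>Accumulation points of sequences with vanishing steps\<close>

text \<open>If the band \<open>[c, d]\<close> were eventually avoided, then once the steps are
  smaller than \<open>d - c\<close> no single step could cross it: from below \<open>c\<close> the
  next value is still below \<open>d\<close>, hence again below \<open>c\<close>. The values above
  \<open>d\<close> could then not recur.\<close>

lemma frequently_between:
  fixes h :: "nat \<Rightarrow> real"
  assumes step: "(\<lambda>k. h (Suc k) - h k) \<longlonglongrightarrow> 0" and "c < d"
    and below: "\<exists>\<^sub>F k in sequentially. h k < c" and above: "\<exists>\<^sub>F k in sequentially. d < h k"
  shows "\<exists>\<^sub>F k in sequentially. c \<le> h k \<and> h k \<le> d"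
proof (rule ccontr)
  assume "\<not> ?thesis"
  then have "\<forall>\<^sub>F k in sequentially. h k < c \<or> d < h k"
    unfolding not_frequently by (rule eventually_mono) auto
  moreover have "\<forall>\<^sub>F k in sequentially. dist (h (Suc k) - h k) 0 < d - c"
    using step \<open>c < d\<close> by (intro tendstoD) auto
  ultimately have "\<forall>\<^sub>F k in sequentially. (h k < c \<or> d < h k) \<and> dist (h (Suc k) - h k) 0 < d - c"
    by (rule eventually_conj)
  then obtain N where N: "\<And>k. k \<ge> N \<Longrightarrow> (h k < c \<or> d < h k) \<and> \<bar>h (Suc k) - h k\<bar> < d - c"
    by (auto simp: eventually_sequentially)
  obtain k0 where k0: "k0 \<ge> N" "h k0 < c"
    using below by (auto simp: frequently_sequentially)
  have "h k < c" if "k \<ge> k0" for k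
    using that
  proof (induction k rule: dec_induct)
    case (step k)
    then show ?case
      using N[of k] N[of "Suc k"] k0 by auto
  qed (use k0 in simp)
  then have "\<forall>\<^sub>F k in sequentially. \<not> d < h k"
    using \<open>c < d\<close> unfolding eventually_sequentially by force
  then show False
    using above by (simp add: frequently_def)
qed

text \<open>This trades subsequences for recurrent visits to balls, the form in which closedness and
  the shell argument work. For the converse, indices are chosen recursively, each beyond the
  previous one, with tolerance \<open>1/(n+1)\<close>.\<close>

lemma accumulation_points_frequently:
  fixes x :: "nat \<Rightarrow> 'a::metric_space"
  shows "a \<in> accumulation_points x \<longleftrightarrow> (\<forall>e>0. \<exists>\<^sub>F k in sequentially. dist (x k) a < e)"
proof
  assume "a \<in> accumulation_points x"
  then obtain s where s: "strict_mono s" "(x \<circ> s) \<longlonglongrightarrow> a"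
    by (auto simp: accumulation_points_def)
  show "\<forall>e>0. \<exists>\<^sub>F k in sequentially. dist (x k) a < e"
  proof (intro allI impI)
    fix e :: real assume "e > 0"
    then have "\<forall>\<^sub>F k in sequentially. dist (x (s k)) a < e"
      using tendstoD[OF s(2), of e] by simp
    then obtain N where N: "\<And>k. k \<ge> N \<Longrightarrow> dist (x (s k)) a < e"
      by (auto simp: eventually_sequentially)
    have "\<exists>k\<ge>n. dist (x k) a < e" for n
      using N[of "max N n"] seq_suble[OF s(1), of "max N n"]
      by (intro exI[of _ "s (max N n)"]) auto
    then show "\<exists>\<^sub>F k in sequentially. dist (x k) a < e"
      by (simp add: frequently_sequentially)
  qed
next
  assume freq: "\<forall>e>0. \<exists>\<^sub>F k in sequentially. dist (x k) a < e"
  have *: "\<exists>k>m. dist (x k) a < inverse (real (Suc n))" for m n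
    using freq[rule_format, of "inverse (real (Suc n))"]
    by (auto simp: frequently_sequentially Suc_le_eq dest!: spec[of _ "Suc m"])
  have "\<exists>s. \<forall>n. dist (x (s n)) a < inverse (real (Suc n)) \<and> s n < s (Suc n)"
    by (rule dependent_nat_choice) (use * in blast)+
  then obtain s where s: "\<And>n. dist (x (s n)) a < inverse (real (Suc n))" "\<And>n. s n < s (Suc n)"
    by blast
  have "(\<lambda>n. dist (x (s n)) a) \<longlonglongrightarrow> 0"
    by (rule tendsto_sandwich[OF _ _ tendsto_const LIMSEQ_inverse_real_of_nat])
      (use s(1) in \<open>auto intro!: always_eventually less_imp_le simp del: of_nat_Suc\<close>)
  then have "(x \<circ> s) \<longlonglongrightarrow> a"
    by (subst tendsto_dist_iff) (simp add: o_def)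
  moreover have "strict_mono s"
    using s(2) by (simp add: strict_mono_Suc_iff)
  ultimately show "a \<in> accumulation_points x"
    by (auto simp: accumulation_points_def)
qed

lemma closed_accumulation_points:
  fixes x :: "nat \<Rightarrow> 'a::metric_space"
  shows "closed (accumulation_points x)"
proof -
  have "a \<in> accumulation_points x" if a: "a \<in> closure (accumulation_points x)" for a
    unfolding accumulation_points_frequently
  proof (intro allI impI)
    fix e :: real assume "e > 0"
    then obtain b where b: "b \<in> accumulation_points x" "dist b a < e / 2"
      using a unfolding closure_approachable by (meson half_gt_zero)
    then have "\<exists>\<^sub>F k in sequentially. dist (x k) b < e / 2"
      using \<open>e > 0\<close> unfolding accumulation_points_frequently by (meson half_gt_zero)
    then show "\<exists>\<^sub>F k in sequentially. dist (x k) a < e"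
      by (rule frequently_elim1) (use b(2) in \<open>metis dist_triangle_half_r dist_commute\<close>)
  qed
  then show ?thesis
    using closure_subset closure_subset_eq by blast
qed

lemma frequently_in_compact_accumulates:
  fixes x :: "nat \<Rightarrow> 'a::metric_space"
  assumes "compact K" and "\<exists>\<^sub>F k in sequentially. x k \<in> K"
  obtains a where "a \<in> K" "a \<in> accumulation_points x"
proof -
  have "infinite {k. x k \<in> K}"
    using assms(2) by (simp add: frequently_cofinite flip: cofinite_eq_sequentially)
  then obtain s :: "nat \<Rightarrow> nat" where s: "strict_mono s" "\<And>n. x (s n) \<in> K"
    using infinite_enumerate by blast
  then have "\<forall>n. (x \<circ> s) n \<in> K"
    by simp
  then obtain a u where a: "a \<in> K" "strict_mono u" "((x \<circ> s) \<circ> u) \<longlonglongrightarrow> a"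
    using \<open>compact K\<close> unfolding compact_def by blast
  then have "a \<in> accumulation_points x"
    using s(1) strict_mono_o[OF s(1) a(2)] unfolding accumulation_points_def by (auto simp: o_assoc)
  with a(1) show thesis by (rule that)
qed

text \<open>Ostrowski's argument: a sequence with vanishing steps cannot jump across the shell.\<close>

lemma accumulation_point_in_shell:
  fixes x :: "nat \<Rightarrow> 'a::heine_borel"
  assumes step: "(\<lambda>k. dist (x (Suc k)) (x k)) \<longlonglongrightarrow> 0"
    and S: "bounded S" "S \<noteq> {}" and "c < d"
    and near: "\<exists>\<^sub>F k in sequentially. infdist (x k) S < c"
    and far: "\<exists>\<^sub>F k in sequentially. d < infdist (x k) S"
  obtains z where "z \<in> accumulation_points x" "c \<le> infdist z S" "infdist z S \<le> d"
proof -
  let ?K = "{z. c \<le> infdist z S \<and> infdist z S \<le> d}"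
  have "(\<lambda>k. infdist (x (Suc k)) S - infdist (x k) S) \<longlonglongrightarrow> 0"
    by (rule Lim_null_comparison[OF _ step]) (simp add: infdist_triangle_abs)
  then have "\<exists>\<^sub>F k in sequentially. x k \<in> ?K"
    using frequently_between[OF _ \<open>c < d\<close> near far] by simp
  moreover have "compact ?K"
  proof (intro compact_eq_bounded_closed[THEN iffD2] conjI)
    obtain b B where B: "\<And>y. y \<in> S \<Longrightarrow> dist b y \<le> B"
      using S(1) by (auto simp: bounded_def)
    have "dist b z \<le> B + (d + 1)" if "z \<in> ?K" for z
    proof -
      \<comment> \<open>The slack 1 makes the inequality strict, so that an actual point of
        \<open>S\<close> within \<open>d + 1\<close> exists even if the infimum is not
        attained.\<close>
      have "infdist z S < d + 1"
        using that by auto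
      then obtain y where "y \<in> S" "dist z y < d + 1"
        using S(2) by (auto simp: infdist_notempty cINF_less_iff)
      then show ?thesis
        using B[of y] dist_triangle[of b z y] by (simp add: dist_commute)
    qed
    then show "bounded ?K"
      unfolding bounded_def by blast
    show "closed ?K"
      by (intro closed_Collect_conj closed_Collect_le continuous_intros)
  qed
  ultimately show thesis
    using that frequently_in_compact_accumulates by blast
qed

text \<open>Two disjoint closed pieces \<open>A\<close> and \<open>B\<close> of this bounded set
  would lie at a distance \<open>e > 0\<close>, and the sequence would visit the vicinity of each
  infinitely often. The shell around \<open>A\<close> with radii \<open>e / 3\<close> and
  \<open>e / 2\<close> then contains an accumulation point that is too far from \<open>A\<close> and
  too close to \<open>A\<close> to lie in \<open>B\<close>.\<close>

lemma connected_accumulation_points: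
  fixes x :: "nat \<Rightarrow> 'a::heine_borel"
  assumes step: "(\<lambda>k. dist (x (Suc k)) (x k)) \<longlonglongrightarrow> 0" and bdd: "bounded (accumulation_points x)"
  shows "connected (accumulation_points x)"
  unfolding connected_closed_set[OF closed_accumulation_points]
proof clarify
  fix A B
  assume AB: "closed A" "closed B" "A \<union> B = accumulation_points x" "A \<inter> B = {}"
    and ne: "A \<noteq> {}" "B \<noteq> {}"
  have bA: "bounded A" and bB: "bounded B"
    using bdd AB(3) by (auto intro: bounded_subset)
  then have "compact B"
    using AB(2) by (simp add: compact_eq_bounded_closed)
  then obtain e where e: "e > 0" "\<And>b a. b \<in> B \<Longrightarrow> a \<in> A \<Longrightarrow> e \<le> dist b a"
    using separate_compact_closed[of B A] AB by blast
  have far: "e \<le> infdist b A" if "b \<in> B" for b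
    using that e ne by (auto simp: infdist_notempty intro!: cINF_greatest)
  obtain a b where ab: "a \<in> A" "b \<in> B"
    using ne by blast
  have "\<exists>\<^sub>F k in sequentially. dist (x k) a < e / 3" "\<exists>\<^sub>F k in sequentially. dist (x k) b < e / 3"
    using ab AB(3) e(1) accumulation_points_frequently[of a x] accumulation_points_frequently[of b x]
    by (metis UnI1 UnI2 divide_pos_pos zero_less_numeral)+
  moreover have "infdist y A < e / 3" if "dist y a < e / 3" for y
    using infdist_le[OF ab(1), of y] that by simp
  moreover have "e / 2 < infdist y A" if "dist y b < e / 3" for y
    using infdist_triangle[of b A y] far[OF ab(2)] that e(1) by (simp add: dist_commute)
  ultimately have "\<exists>\<^sub>F k in sequentially. infdist (x k) A < e / 3"
    "\<exists>\<^sub>F k in sequentially. e / 2 < infdist (x k) A"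
    by (auto elim: frequently_elim1)
  then obtain z where z: "z \<in> accumulation_points x" "e / 3 \<le> infdist z A" "infdist z A \<le> e / 2"
    using accumulation_point_in_shell[OF step bA ne(1), of "e / 3" "e / 2"] e(1) by auto
  then show False
    using e(1) far[of z] AB(3) by force
qed

text \<open>If the sequence left a neighbourhood of \<open>a\<close> infinitely often, it would
  accumulate in a small shell around \<open>a\<close>, where isolation leaves no other accumulation
  point.\<close>

lemma isolated_accumulation_point_limit:
  fixes x :: "nat \<Rightarrow> 'a::heine_borel"
  assumes step: "(\<lambda>k. dist (x (Suc k)) (x k)) \<longlonglongrightarrow> 0" and iso: "a isolated_in accumulation_points x"
  shows "x \<longlonglongrightarrow> a"
proof (rule tendstoI, rule ccontr)
  fix e :: real
  assume "e > 0" and "\<not> (\<forall>\<^sub>F k in sequentially. dist (x k) a < e)"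
  then have far: "\<exists>\<^sub>F k in sequentially. e \<le> dist (x k) a"
    by (simp add: frequently_def not_le)
  obtain T where T: "open T" "T \<inter> accumulation_points x = {a}" and a: "a \<in> accumulation_points x"
    using iso by (auto simp: isolated_in_def)
  then obtain \<delta> where \<delta>: "\<delta> > 0" "\<And>y. dist y a < \<delta> \<Longrightarrow> y \<in> T"
    by (auto simp: open_dist dest!: bspec[of _ _ a])
  \<comment> \<open>A third keeps the outer radius \<open>2 * c\<close> of the shell below both
    \<open>e\<close> and \<open>\<delta>\<close>.\<close>
  define c where "c = min e \<delta> / 3"
  have c: "c > 0" "2 * c < e" "2 * c < \<delta>"
    using \<open>e > 0\<close> \<delta>(1) by (auto simp: c_def)
  have "\<exists>\<^sub>F k in sequentially. infdist (x k) {a} < c"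
    using a c(1) by (simp add: accumulation_points_frequently)
  moreover have "\<exists>\<^sub>F k in sequentially. 2 * c < infdist (x k) {a}"
    using far by (rule frequently_elim1) (use c(2) in simp)
  ultimately obtain z where "z \<in> accumulation_points x" "c \<le> infdist z {a}" "infdist z {a} \<le> 2 * c"
    using accumulation_point_in_shell[OF step, of "{a}" c "2 * c"] c(1) by auto
  then show False
    using \<delta>(2)[of z] T(2) c by (metis Int_iff dist_self infdist_singleton le_less_trans not_le singletonD)
qed

text \<open>The limit \<open>L\<close> is a lower bound of \<open>a\<close>. If it were positive,
  then eventually \<open>q * a k < L\<close>, which excludes every further contraction. This is
  applied to both tolerances \<open>\<epsilon>\<close> and \<open>r\<close>.\<close>

lemma frequent_contraction_tendsto_0:
  fixes a :: "nat \<Rightarrow> real"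
  assumes "decseq a" "\<And>k. a k > 0" "q \<in> {0<..<1}"
    and contr: "\<exists>\<^sub>F k in sequentially. a (Suc k) = q * a k"
  shows "a \<longlonglongrightarrow> 0"
proof -
  obtain L where L: "a \<longlonglongrightarrow> L" "\<And>i. L \<le> a i"
    using decseq_convergent[OF assms(1), of 0] assms(2) less_imp_le by metis
  have "L \<ge> 0"
    using L(1) assms(2) by (intro LIMSEQ_le_const) (auto intro: less_imp_le)
  moreover have "\<not> L > 0"
  proof
    assume "L > 0"
    then have "q * L < L"
      using assms(3) by simp
    then have "\<forall>\<^sub>F k in sequentially. q * a k < L"
      by (intro order_tendstoD(2)[OF tendsto_mult[OF tendsto_const L(1)]])
    then have "\<forall>\<^sub>F k in sequentially. a (Suc k) \<noteq> q * a k"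
      by (rule eventually_mono) (use L(2) in \<open>metis not_le\<close>)
    then show False
      using contr by (simp add: frequently_def)
  qed
  ultimately show ?thesis
    using L(1) by (simp add: order_less_le)
qed

subsection \<open>Proximal points of weakly convex functions\<close>

lemma lsc_fun_tendsto:
  fixes y :: "nat \<Rightarrow> 'a::topological_space"
  assumes "lsc_fun g" "y \<longlonglongrightarrow> a" "b \<longlonglongrightarrow> c"
    and "\<And>k. g (y k) \<le> ereal (b k)"
  shows "g a \<le> ereal c"
proof (rule ccontr)
  assume "\<not> g a \<le> ereal c"
  then obtain z where z: "ereal c < z" "z < g a"
    using dense not_le by metis
  have "z < Liminf (at a) g"
    using assms(1) z(2) unfolding lsc_fun_def by (meson less_le_trans)
  \<comment> \<open>\<open>Liminf (at a)\<close> ignores the point \<open>a\<close> itself, but the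
    sequence may hit it; there the bound holds by the choice of \<open>z\<close>.\<close>
  then have "\<forall>\<^sub>F u in nhds a. z < g u"
    using z(2) less_LiminfD by (auto simp: eventually_nhds_conv_at)
  then have "\<forall>\<^sub>F k in sequentially. z < g (y k)"
    using assms(2) by (rule eventually_compose_filterlim)
  then have "\<forall>\<^sub>F k in sequentially. z \<le> ereal (b k)"
    by (rule eventually_mono) (use assms(4) in \<open>meson less_imp_le less_le_trans\<close>)
  then have "z \<le> ereal c"
    using tendsto_ereal[OF assms(3)] by (intro tendsto_lowerbound) auto
  with z(1) show False by simp
qed

text \<open>Otherwise there are points of \<open>K\<close> with \<open>g (y n) \<le> -n\<close>, and
  lower semicontinuity forces the value \<open>-\<infinity>\<close> at a limit of a
  subsequence.\<close>

lemma lsc_fun_compact_lower_bound: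
  fixes g :: "'a::metric_space \<Rightarrow> ereal"
  assumes "lsc_fun g" "\<And>y. g y \<noteq> -\<infinity>" "compact K"
  obtains m where "\<And>y. y \<in> K \<Longrightarrow> ereal m \<le> g y"
proof (rule ccontr)
  assume "\<not> thesis"
  then have "\<exists>y. y \<in> K \<and> g y \<le> ereal (- real n)" for n
    using that[of "- real n"] by (meson linear)
  then obtain y where y: "\<And>n. y n \<in> K" "\<And>n. g (y n) \<le> ereal (- real n)"
    by metis
  then obtain a s where a: "strict_mono s" "(y \<circ> s) \<longlonglongrightarrow> a"
    using \<open>compact K\<close> unfolding compact_def by metis
  have "g a \<le> ereal c" for c
  proof -
    obtain N where N: "- real N < c"
      using reals_Archimedean2[of "-c"] by (auto simp: minus_less_iff)
    \<comment> \<open>Dropping the first \<open>N\<close> terms makes the bound by \<open>c\<close>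
      hold for every index, as \<open>lsc_fun_tendsto\<close> demands.\<close>
    have "(\<lambda>n. (y \<circ> s) (n + N)) \<longlonglongrightarrow> a"
      using a(2) by (rule LIMSEQ_ignore_initial_segment)
    moreover have "g ((y \<circ> s) (n + N)) \<le> ereal c" for n
    proof -
      have "- real (s (n + N)) \<le> c"
        using seq_suble[OF a(1), of "n + N"] N by linarith
      then show ?thesis
        using y(2)[of "s (n + N)"] by (simp add: order_trans)
    qed
    ultimately show ?thesis
      by (rule lsc_fun_tendsto[OF assms(1) _ tendsto_const])
  qed
  then have "g a = -\<infinity>"
    by (rule ereal_bot)
  with assms(2) show False by simp
qed

text \<open>A lower bound on the unit ball propagates along rays through its centre, so no separation
  theorem (affine minorant) is needed.\<close>

lemma ereal_convex_linear_lower_bound: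
  fixes f :: "'a::real_normed_vector \<Rightarrow> ereal"
  assumes conv: "ereal_convex f" and c: "f a = ereal c"
    and m: "\<And>y. y \<in> cball a 1 \<Longrightarrow> ereal m \<le> f y"
  shows "ereal (- (\<bar>m\<bar> + \<bar>c\<bar>) * (1 + norm (y - a))) \<le> f y"
proof -
  define D where "D = \<bar>m\<bar> + \<bar>c\<bar>"
  define n where "n = norm (y - a)"
  have D: "D \<ge> 0" by (simp add: D_def)
  have "ereal (- D * (1 + n)) \<le> f y"
  proof (cases "n \<le> 1")
    case True
    have "D * 1 \<le> D * (1 + n)"
      using D by (intro mult_left_mono) (auto simp: n_def)
    moreover have "\<bar>m\<bar> \<le> D"
      by (simp add: D_def)
    ultimately have "- D * (1 + n) \<le> m"
      unfolding mult_minus_left by linarith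
    moreover have "ereal m \<le> f y"
      using True by (intro m) (simp add: n_def dist_norm norm_minus_commute)
    ultimately show ?thesis
      by (meson ereal_less_eq(3) order_trans)
  next
    case False
    \<comment> \<open>With this weight, \<open>z\<close> is the point where the segment from
      \<open>a\<close> to \<open>y\<close> meets the unit sphere around \<open>a\<close>.\<close>
    define u where "u = 1 / n"
    have u: "u \<in> {0<..<1}" "u * n = 1"
      using False by (auto simp: u_def)
    define z where "z = (1 - u) *\<^sub>R a + u *\<^sub>R y"
    have "z - a = u *\<^sub>R (y - a)"
      by (simp add: z_def algebra_simps)
    then have "norm (z - a) = 1"
      using u by (simp add: n_def)
    then have "ereal m \<le> f z"
      by (intro m) (simp add: dist_norm norm_minus_commute)
    also have "f z \<le> ereal (1 - u) * f a + ereal u * f y"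
      using conv u(1) by (simp add: ereal_convex_def z_def)
    finally have *: "ereal m \<le> ereal ((1 - u) * c) + ereal u * f y"
      by (simp add: c)
    show ?thesis
    proof (cases "f y")
      case (real v)
      have "m \<le> (1 - u) * c + u * v"
        using * real by simp
      moreover have "(1 - u) * c \<le> (1 - u) * \<bar>c\<bar>" "(1 - u) * \<bar>c\<bar> \<le> 1 * \<bar>c\<bar>"
        using u(1) by (intro mult_left_mono mult_right_mono; simp)+
      ultimately have "- D \<le> u * v"
        by (simp add: D_def)
      then have "n * - D \<le> n * (u * v)"
        using False by (intro mult_left_mono) auto
      also have "n * (u * v) = v"
        using u(2) by (metis mult.assoc mult.commute mult_1)
      finally show ?thesis
        using real D by (simp add: algebra_simps)
    next
      case MInf
      then show ?thesis
        using * u(1) by simp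
    qed simp
  qed
  then show ?thesis
    by (simp add: D_def n_def)
qed

section \<open>Coercivity of the proximal objective; existence and uniqueness of its
  minimizer\<close>

definition prox_objective :: "real \<Rightarrow> ('a::euclidean_space \<Rightarrow> ereal) \<Rightarrow> 'a \<Rightarrow> 'a \<Rightarrow> ereal" where
  "prox_objective lam g x y = g y + ereal (1 / (2 * lam) * (norm (y - x))\<^sup>2)"

lemma mem_Prox_set_iff:
  "y \<in> Prox_set lam g x \<longleftrightarrow> (\<forall>z. prox_objective lam g x y \<le> prox_objective lam g x z)"
  by (auto simp: Prox_set_def is_arg_min_def prox_objective_def not_less)

text \<open>Completing the square: the right side exceeds the left by
  \<open>(\<kappa> * n - (1 + a))^2 / (2 * \<kappa>)\<close>.\<close>

lemma linear_le_quadratic: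
  fixes n :: real
  assumes "\<kappa> > 0"
  shows "n - ((1 + a)\<^sup>2 / (2 * \<kappa>) + b) \<le> \<kappa> / 2 * n\<^sup>2 - a * n - b"
proof -
  have "0 \<le> (\<kappa> * n - (1 + a))\<^sup>2 / (2 * \<kappa>)"
    using assms by simp
  also have "\<dots> = \<kappa> / 2 * n\<^sup>2 - (1 + a) * n + (1 + a)\<^sup>2 / (2 * \<kappa>)"
    using assms by (simp add: power2_eq_square field_simps)
  finally show ?thesis
    by (simp add: algebra_simps)
qed

text \<open>Weak convexity lets \<open>g\<close> fall at most like a linear term plus
  \<open>\<rho>/2 * (norm y)^2\<close>, and the proximal quadratic outweighs this because
  \<open>1/lam > \<rho>\<close>. Uniformity in \<open>norm x \<le> R\<close> yields both the
  existence of proximal points and a lower bound of the envelope on balls.\<close>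

lemma prox_objective_coercive:
  fixes g :: "'a::euclidean_space \<Rightarrow> ereal"
  assumes wc: "weakly_convex \<rho> g" and lam: "lam > 0" "lam * \<rho> < 1"
  obtains \<beta> where "\<And>x y. norm x \<le> R \<Longrightarrow> ereal (norm y - \<beta>) \<le> prox_objective lam g x y"
proof -
  have \<rho>: "\<rho> \<ge> 0" and g: "\<And>x. g x \<noteq> -\<infinity>" "lsc_fun g"
    and conv: "ereal_convex (\<lambda>x. g x + ereal (\<rho> / 2 * (norm x)\<^sup>2))"
    using wc by (auto simp: weakly_convex_def proper_fun_def)
  obtain a where "g a \<noteq> \<infinity>"
    using wc by (auto simp: weakly_convex_def proper_fun_def)
  then obtain ga where ga: "g a = ereal ga"
    using g(1)[of a] by (cases "g a") auto
  obtain m where m: "\<And>y. y \<in> cball a 1 \<Longrightarrow> ereal m \<le> g y"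
    using lsc_fun_compact_lower_bound[OF g(2,1) compact_cball] by blast
  define C where "C = \<bar>m\<bar> + \<bar>ga + \<rho> / 2 * (norm a)\<^sup>2\<bar>"
  have C: "ereal (- C * (1 + norm (y - a))) \<le> g y + ereal (\<rho> / 2 * (norm y)\<^sup>2)" for y
    unfolding C_def
  proof (rule ereal_convex_linear_lower_bound[OF conv])
    fix z assume "z \<in> cball a 1"
    then show "ereal m \<le> g z + ereal (\<rho> / 2 * (norm z)\<^sup>2)"
      using add_mono[OF m, of z 0 "ereal (\<rho> / 2 * (norm z)\<^sup>2)"] \<rho> by simp
  qed (simp add: ga)
  \<comment> \<open>The surviving lower bound is \<open>\<kappa>/2 * n^2 - A * n - b\<close> with
    \<open>n = norm y\<close>.\<close>
  define \<kappa> where "\<kappa> = 1 / lam - \<rho>"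
  have \<kappa>: "\<kappa> > 0"
    using lam by (simp add: \<kappa>_def field_simps)
  define A where "A = C + R / lam"
  define b where "b = C * (1 + norm a)"
  have "ereal (norm y - ((1 + A)\<^sup>2 / (2 * \<kappa>) + b)) \<le> prox_objective lam g x y"
    if x: "norm x \<le> R" for x y
  proof (cases "g y")
    case (real v)
    have "C * norm (y - a) \<le> C * (norm y + norm a)"
      by (intro mult_left_mono norm_triangle_ineq4) (simp add: C_def)
    then have v: "- C * norm y - b - \<rho> / 2 * (norm y)\<^sup>2 \<le> v"
      using C[of y] real by (simp add: b_def algebra_simps)
    have "0 \<le> 2 * (R * norm y - norm x * norm y) + (norm x)\<^sup>2"
      using mult_right_mono[OF x norm_ge_zero[of y]] by simp
    also have "\<dots> = (norm y - norm x)\<^sup>2 - ((norm y)\<^sup>2 - 2 * R * norm y)"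
      by (simp add: power2_diff algebra_simps)
    finally have "(norm y)\<^sup>2 - 2 * R * norm y \<le> (norm y - norm x)\<^sup>2"
      by simp
    also have "\<dots> \<le> (norm (y - x))\<^sup>2"
      using norm_triangle_ineq3[of y x] by (metis abs_ge_zero power2_abs power_mono)
    finally have "1 / (2 * lam) * ((norm y)\<^sup>2 - 2 * R * norm y) \<le> 1 / (2 * lam) * (norm (y - x))\<^sup>2"
      using lam by (intro mult_left_mono) auto
    then have q: "(norm y)\<^sup>2 / (2 * lam) - R / lam * norm y \<le> 1 / (2 * lam) * (norm (y - x))\<^sup>2"
      using lam by (simp add: field_simps)
    have "norm y - ((1 + A)\<^sup>2 / (2 * \<kappa>) + b) \<le> \<kappa> / 2 * (norm y)\<^sup>2 - A * norm y - b"
      by (rule linear_le_quadratic[OF \<kappa>])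
    also have "\<dots> = (- C * norm y - b - \<rho> / 2 * (norm y)\<^sup>2) + ((norm y)\<^sup>2 / (2 * lam) - R / lam * norm y)"
      by (simp add: \<kappa>_def A_def field_simps)
    also have "\<dots> \<le> v + 1 / (2 * lam) * (norm (y - x))\<^sup>2"
      by (rule add_mono[OF v q])
    finally show ?thesis
      by (simp add: prox_objective_def real)
  qed (use g in \<open>auto simp: prox_objective_def\<close>)
  then show thesis by (rule that)
qed

text \<open>The direct method: a minimizing sequence is bounded by coercivity, and lower
  semicontinuity makes the limit of a subsequence a minimizer.\<close>

lemma Prox_set_nonempty:
  fixes g :: "'a::euclidean_space \<Rightarrow> ereal"
  assumes wc: "weakly_convex \<rho> g" and lam: "lam > 0" "lam * \<rho> < 1"
  shows "Prox_set lam g x \<noteq> {}"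
proof -
  let ?\<phi> = "prox_objective lam g x"
  obtain \<beta> where \<beta>: "\<And>y :: 'a. ereal (norm y - \<beta>) \<le> ?\<phi> y"
    using prox_objective_coercive[OF assms, of "norm x"] by (metis order_refl)
  define I where "I = (INF y. ?\<phi> y)"
  have "ereal (- \<beta>) \<le> I"
    unfolding I_def
  proof (rule INF_greatest)
    fix y :: 'a
    have "ereal (- \<beta>) \<le> ereal (norm y - \<beta>)" by simp
    then show "ereal (- \<beta>) \<le> ?\<phi> y" using \<beta>[of y] by (rule order_trans)
  qed
  moreover have "I < \<infinity>"
  proof -
    obtain a where "g a \<noteq> \<infinity>"
      using wc by (auto simp: weakly_convex_def proper_fun_def)
    then have "?\<phi> a < \<infinity>"
      by (simp add: prox_objective_def)
    then show ?thesis
      unfolding I_def by (meson INF_lower UNIV_I le_less_trans)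
  qed
  ultimately obtain i where i: "I = ereal i"
    by (cases I) auto
  have "\<exists>y. ?\<phi> y < ereal (i + inverse (real (Suc n)))" for n
  proof -
    have "I < ereal (i + inverse (real (Suc n)))"
      by (simp add: i del: of_nat_Suc)
    then show ?thesis
      by (simp add: I_def INF_less_iff)
  qed
  then obtain y where y: "\<And>n. ?\<phi> (y n) < ereal (i + inverse (real (Suc n)))"
    by metis
  have "norm (y n) \<le> \<beta> + i + 1" for n
  proof -
    have "ereal (norm (y n) - \<beta>) < ereal (i + inverse (real (Suc n)))"
      using \<beta> y by (rule le_less_trans)
    moreover have "inverse (real (Suc n)) \<le> 1"
      by (simp add: field_simps)
    ultimately show ?thesis by simp
  qed
  then have "\<And>n. y n \<in> cball 0 (\<beta> + i + 1)"
    by simp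
  then obtain z s where z: "strict_mono s" "(y \<circ> s) \<longlonglongrightarrow> z"
    using compact_cball[of "0::'a"] unfolding compact_def by metis
  \<comment> \<open>Moving the continuous quadratic term to the real side leaves \<open>g\<close>
    alone on the left, so that its lower semicontinuity applies directly.\<close>
  let ?b = "\<lambda>n. i + inverse (real (Suc n)) - 1 / (2 * lam) * (norm (y n - x))\<^sup>2"
  have "(\<lambda>n. inverse (real (Suc (s n)))) \<longlonglongrightarrow> 0"
    using LIMSEQ_subseq_LIMSEQ[OF LIMSEQ_inverse_real_of_nat z(1)] by (simp add: o_def)
  then have "(\<lambda>n. ?b (s n)) \<longlonglongrightarrow> i + 0 - 1 / (2 * lam) * (norm (z - x))\<^sup>2"
    using z(2) unfolding o_def by (intro tendsto_intros)
  moreover have "g ((y \<circ> s) n) \<le> ereal (?b (s n))" for n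
    using y[of "s n"] by (cases "g (y (s n))") (auto simp: prox_objective_def)
  ultimately have "g z \<le> ereal (i + 0 - 1 / (2 * lam) * (norm (z - x))\<^sup>2)"
    using wc z(2) lsc_fun_tendsto unfolding weakly_convex_def by blast
  then have "?\<phi> z \<le> I"
    by (cases "g z") (auto simp: prox_objective_def i)
  then have "z \<in> Prox_set lam g x"
    unfolding mem_Prox_set_iff I_def by (meson INF_lower UNIV_I order_trans)
  then show ?thesis by blast
qed

text \<open>The parallelogram law, read as the exact convexity gain of the squared norm at a
  midpoint.\<close>

lemma norm_midpoint_square:
  fixes y z :: "'a::real_inner"
  shows "(norm ((1/2) *\<^sub>R y + (1/2) *\<^sub>R z))\<^sup>2 = (norm y)\<^sup>2 / 2 + (norm z)\<^sup>2 / 2 - (norm (y - z))\<^sup>2 / 4"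
  by (simp add: power2_norm_eq_inner inner_simps inner_commute field_simps)

text \<open>At the midpoint of two minimizers \<open>y\<close> and \<open>z\<close>, weak convexity
  costs at most \<open>\<rho>/8 * (norm (y - z))^2\<close>, while the proximal term gains
  \<open>1/(8 * lam)\<close> times the same square. As \<open>1/lam > \<rho>\<close>, optimality
  forces \<open>y = z\<close>. This justifies \<open>the_elem\<close> in
  \<open>Prox\<close>.\<close>

lemma Prox_set_singleton:
  fixes g :: "'a::euclidean_space \<Rightarrow> ereal"
  assumes wc: "weakly_convex \<rho> g" and lam: "lam > 0" "lam * \<rho> < 1"
  shows "Prox_set lam g x = {Prox lam g x}"
proof -
  have fin: "\<exists>v. g y = ereal v" if "y \<in> Prox_set lam g x" for y
  proof -
    obtain a where "g a \<noteq> \<infinity>" and "g y \<noteq> -\<infinity>"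
      using wc by (auto simp: weakly_convex_def proper_fun_def)
    moreover have "prox_objective lam g x y \<le> prox_objective lam g x a"
      using that by (simp add: mem_Prox_set_iff)
    ultimately show ?thesis
      by (cases "g y"; cases "g a") (auto simp: prox_objective_def)
  qed
  have uniq: "y = z" if yz: "y \<in> Prox_set lam g x" "z \<in> Prox_set lam g x" for y z
  proof -
    obtain v w where vw: "g y = ereal v" "g z = ereal w"
      using fin yz by blast
    define q where "q u = 1 / (2 * lam) * (norm (u - x))\<^sup>2" for u
    define p where "p = (1/2) *\<^sub>R y + (1/2) *\<^sub>R z"
    have "prox_objective lam g x y \<le> prox_objective lam g x p"
      "prox_objective lam g x z \<le> prox_objective lam g x p"
      using yz by (auto simp: mem_Prox_set_iff)
    note opt = this
    have conv: "ereal_convex (\<lambda>x. g x + ereal (\<rho> / 2 * (norm x)\<^sup>2))"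
      using wc by (simp add: weakly_convex_def)
    have "g p + ereal (\<rho> / 2 * (norm p)\<^sup>2) \<le>
        ereal (1/2) * (g y + ereal (\<rho> / 2 * (norm y)\<^sup>2)) + ereal (1/2) * (g z + ereal (\<rho> / 2 * (norm z)\<^sup>2))"
      using conv[unfolded ereal_convex_def, rule_format, of "1/2" y z] by (simp add: p_def)
    then have cv: "g p + ereal (\<rho> / 2 * (norm p)\<^sup>2) \<le>
        ereal ((v + \<rho> / 2 * (norm y)\<^sup>2) / 2 + (w + \<rho> / 2 * (norm z)\<^sup>2) / 2)"
      by (simp add: vw)
    moreover have "g p \<noteq> -\<infinity>"
      using wc by (simp add: weakly_convex_def proper_fun_def)
    ultimately obtain s where s: "g p = ereal s"
      by (cases "g p") auto
    have o: "v + q y \<le> s + q p" "w + q z \<le> s + q p"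
      using opt by (simp_all add: prox_objective_def vw s q_def)
    have "s + \<rho> / 2 * (norm p)\<^sup>2 \<le> (v + \<rho> / 2 * (norm y)\<^sup>2) / 2 + (w + \<rho> / 2 * (norm z)\<^sup>2) / 2"
      using cv by (simp add: s)
    then have c: "s \<le> (v + w) / 2 + \<rho> * (norm (y - z))\<^sup>2 / 8"
      unfolding p_def norm_midpoint_square by (simp add: field_simps)
    have px: "p - x = (1/2) *\<^sub>R (y - x) + (1/2) *\<^sub>R (z - x)"
      by (simp add: p_def algebra_simps flip: scaleR_left_distrib)
    have qp: "q p = q y / 2 + q z / 2 - (norm (y - z))\<^sup>2 / lam / 8"
      unfolding q_def px norm_midpoint_square using lam(1) by (simp add: field_simps)
    have "(norm (y - z))\<^sup>2 / lam \<le> \<rho> * (norm (y - z))\<^sup>2"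
      using o c qp by argo
    then have "(1 / lam - \<rho>) * (norm (y - z))\<^sup>2 \<le> 0"
      by (simp add: algebra_simps)
    moreover have "1 / lam - \<rho> > 0"
      using lam by (simp add: field_simps)
    ultimately show ?thesis
      by (simp add: mult_le_0_iff)
  qed
  obtain y where "y \<in> Prox_set lam g x"
    using Prox_set_nonempty[OF assms] by blast
  then have "Prox_set lam g x = {y}"
    using uniq by blast
  then show ?thesis
    by (simp add: Prox_def)
qed

lemma Prox_minimizes:
  fixes g :: "'a::euclidean_space \<Rightarrow> ereal"
  assumes "weakly_convex \<rho> g" "lam > 0" "lam * \<rho> < 1"
  shows "prox_objective lam g x (Prox lam g x) \<le> prox_objective lam g x y"
  using Prox_set_singleton[OF assms, of x] mem_Prox_set_iff[of "Prox lam g x" lam g x] by simp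

text \<open>Minimality of \<open>a\<close> bounds the difference quotient below by
  \<open>- norm (x - a) / (2 * lam)\<close>, which tends to 0. So 0 is a regular subgradient, and
  constant sequences place it in the limiting subdifferential.\<close>

lemma prox_fixed_point_stationary:
  fixes g :: "'a::euclidean_space \<Rightarrow> ereal"
  assumes "\<bar>g a\<bar> \<noteq> \<infinity>" "lam > 0" and min: "a \<in> Prox_set lam g a"
  shows "stationary_point g a"
proof -
  obtain v where v: "g a = ereal v"
    using assms(1) by auto
  have "0 \<le> Liminf (at a) (\<lambda>x. (g x - g a - ereal (0 \<bullet> (x - a))) / ereal (norm (x - a)))"
    unfolding le_Liminf_iff
  proof (intro allI impI)
    fix c :: ereal
    assume "c < 0"
    then obtain c' where c': "c < ereal c'" "c' < 0"
      using ereal_dense2[of c 0] by (auto simp: zero_ereal_def)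
    \<comment> \<open>Within this radius of \<open>a\<close> the lower bound of the quotient stays
      above \<open>c'\<close>.\<close>
    have "0 < 2 * lam * - c'"
      using c'(2) assms(2) by (simp add: mult_pos_neg)
    then have "\<forall>\<^sub>F x in at a. dist x a < 2 * lam * - c'"
      unfolding eventually_at by blast
    moreover have "\<forall>\<^sub>F x in at a. x \<noteq> a"
      by (simp add: eventually_at_filter)
    ultimately show "\<forall>\<^sub>F x in at a. c < (g x - g a - ereal (0 \<bullet> (x - a))) / ereal (norm (x - a))"
    proof eventually_elim
      case (elim x)
      define n where "n = norm (x - a)"
      have n: "n > 0" "n < 2 * lam * - c'"
        using elim by (auto simp: n_def dist_norm)
      have le: "g a \<le> g x + ereal (1 / (2 * lam) * n\<^sup>2)"
        using min by (simp add: mem_Prox_set_iff prox_objective_def n_def zero_ereal_def[symmetric])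
      have "ereal c' < (g x - g a) / ereal n"
      proof (cases "g x")
        case (real w)
        have "c' < - n / (2 * lam)"
          using n(2) assms(2) by (simp add: field_simps)
        also have "\<dots> = - (1 / (2 * lam) * n\<^sup>2) / n"
          using n(1) by (simp add: power2_eq_square)
        also have "\<dots> \<le> (w - v) / n"
          using le n(1) by (intro divide_right_mono) (auto simp: real v)
        finally show ?thesis
          using n(1) by (simp add: real v)
      next
        case PInf
        then show ?thesis using n(1) by (simp add: v)
      next
        case MInf
        then show ?thesis using le by (simp add: v)
      qed
      with c'(1) have "c < (g x - g a) / ereal n"
        by (rule less_trans)
      then show ?case
        by (simp add: n_def zero_ereal_def[symmetric])
    qed
  qed
  then have "0 \<in> regular_subdifferential g a"
    using assms(1) by (simp add: regular_subdifferential_def)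
  then show ?thesis
    unfolding stationary_point_def limiting_subdifferential_def
    using assms(1) by (intro CollectI conjI exI[of _ "\<lambda>_. a"] exI[of _ "\<lambda>_. 0"]) auto
qed

text \<open>The graph of the proximal mapping is closed: compare \<open>P k\<close> with a fixed
  competitor \<open>y\<close> and pass to the limit by lower semicontinuity. A competitor of finite
  value also gives finiteness of \<open>g b\<close>.\<close>

lemma Prox_set_limit:
  fixes g :: "'a::euclidean_space \<Rightarrow> ereal"
  assumes g: "proper_fun g" "lsc_fun g"
    and P: "\<And>k. P k \<in> Prox_set lam g (x k)" and lim: "x \<longlonglongrightarrow> a" "P \<longlonglongrightarrow> b"
  shows "b \<in> Prox_set lam g a" "\<bar>g b\<bar> \<noteq> \<infinity>"
proof -
  have bound: "g b \<le> ereal (v + 1 / (2 * lam) * (norm (y - a))\<^sup>2 - 1 / (2 * lam) * (norm (b - a))\<^sup>2)"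
    if v: "g y = ereal v" for y v
  proof (rule lsc_fun_tendsto[OF g(2) lim(2)])
    show "(\<lambda>k. v + 1 / (2 * lam) * (norm (y - x k))\<^sup>2 - 1 / (2 * lam) * (norm (P k - x k))\<^sup>2) \<longlonglongrightarrow>
        v + 1 / (2 * lam) * (norm (y - a))\<^sup>2 - 1 / (2 * lam) * (norm (b - a))\<^sup>2"
      using lim by (intro tendsto_intros)
    fix k
    have "prox_objective lam g (x k) (P k) \<le> prox_objective lam g (x k) y"
      using P by (simp add: mem_Prox_set_iff)
    then show "g (P k) \<le> ereal (v + 1 / (2 * lam) * (norm (y - x k))\<^sup>2 - 1 / (2 * lam) * (norm (P k - x k))\<^sup>2)"
      by (cases "g (P k)") (auto simp: prox_objective_def v)
  qed
  have fin: "g y = \<infinity> \<or> (\<exists>v. g y = ereal v)" for y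
    using g(1) by (cases "g y") (auto simp: proper_fun_def)
  have "prox_objective lam g a b \<le> prox_objective lam g a y" for y
    using fin[of y] bound[of y] by (cases "g b") (auto simp: prox_objective_def)
  then show "b \<in> Prox_set lam g a"
    by (simp add: mem_Prox_set_iff)
  obtain y where "g y \<noteq> \<infinity>"
    using g(1) by (auto simp: proper_fun_def)
  then show "\<bar>g b\<bar> \<noteq> \<infinity>"
    using fin[of y] fin[of b] bound[of y] by auto
qed

subsection \<open>Descent of the Moreau envelope\<close>

text \<open>Real-valued, so that the descent estimates are ordinary arithmetic.
  \<open>real_of_ereal\<close> would send infinite values to 0; \<open>ereal_moreau_env\<close>
  excludes them for weakly convex \<open>g\<close> and \<open>lam * \<rho> < 1\<close>.\<close>

definition moreau_env :: "real \<Rightarrow> ('a::euclidean_space \<Rightarrow> ereal) \<Rightarrow> 'a \<Rightarrow> real" where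
  "moreau_env lam g x = real_of_ereal (prox_objective lam g x (Prox lam g x))"

lemma ereal_moreau_env:
  fixes g :: "'a::euclidean_space \<Rightarrow> ereal"
  assumes wc: "weakly_convex \<rho> g" and lam: "lam > 0" "lam * \<rho> < 1"
  shows "ereal (moreau_env lam g x) = prox_objective lam g x (Prox lam g x)"
proof -
  let ?p = "prox_objective lam g x (Prox lam g x)"
  obtain a where "g a \<noteq> \<infinity>"
    using wc by (auto simp: weakly_convex_def proper_fun_def)
  then have "prox_objective lam g x a \<noteq> \<infinity>"
    by (simp add: prox_objective_def)
  then have "?p \<noteq> \<infinity>"
    using Prox_minimizes[OF assms, of x a] by auto
  moreover have "?p \<noteq> -\<infinity>"
    using wc by (simp add: weakly_convex_def proper_fun_def prox_objective_def)
  ultimately show ?thesis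
    by (cases ?p) (auto simp: moreau_env_def)
qed

lemma moreau_env_lower_bound:
  fixes g :: "'a::euclidean_space \<Rightarrow> ereal"
  assumes "weakly_convex \<rho> g" "lam > 0" "lam * \<rho> < 1"
  obtains \<beta> where "\<And>x. norm x \<le> R \<Longrightarrow> \<beta> \<le> moreau_env lam g x"
proof -
  obtain \<beta> where \<beta>: "\<And>x y. norm x \<le> R \<Longrightarrow> ereal (norm y - \<beta>) \<le> prox_objective lam g x y"
    using prox_objective_coercive[OF assms, of R] by blast
  have "- \<beta> \<le> moreau_env lam g x" if "norm x \<le> R" for x
  proof -
    have "ereal (norm (Prox lam g x) - \<beta>) \<le> ereal (moreau_env lam g x)"
      using \<beta>[OF that] by (simp add: ereal_moreau_env[OF assms])
    then have "norm (Prox lam g x) - \<beta> \<le> moreau_env lam g x" by simp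
    then show ?thesis
      using norm_ge_zero[of "Prox lam g x"] by linarith
  qed
  then show thesis by (rule that)
qed

text \<open>The envelope minus \<open>1/(2 lam) * (norm x)^2\<close> is an infimum of affine functions, so the descent
  inequality holds with constant \<open>1/lam\<close>, without any Lipschitz estimate of the gradient.\<close>

lemma moreau_env_descent:
  fixes g :: "'a::euclidean_space \<Rightarrow> ereal"
  assumes "weakly_convex \<rho> g" "lam > 0" "lam * \<rho> < 1"
  shows "moreau_env lam g (x + h) \<le>
    moreau_env lam g x + (inverse lam *\<^sub>R (x - Prox lam g x)) \<bullet> h + (norm h)\<^sup>2 / (2 * lam)"
proof -
  let ?p = "Prox lam g x"
  \<comment> \<open>The proximal point of \<open>x\<close> is the competitor in the minimization at
    \<open>x + h\<close>.\<close>
  have "ereal (moreau_env lam g (x + h)) \<le> prox_objective lam g (x + h) ?p"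
    using Prox_minimizes[OF assms] by (simp add: ereal_moreau_env[OF assms])
  moreover obtain v where v: "g ?p = ereal v"
    using ereal_moreau_env[OF assms, of x] by (cases "g ?p") (auto simp: prox_objective_def)
  ultimately have le: "moreau_env lam g (x + h) \<le> v + 1 / (2 * lam) * (norm (?p - (x + h)))\<^sup>2"
    by (simp add: prox_objective_def)
  have eq: "moreau_env lam g x = v + 1 / (2 * lam) * (norm (?p - x))\<^sup>2"
    using ereal_moreau_env[OF assms, of x] by (simp add: prox_objective_def v)
  have "(norm (?p - (x + h)))\<^sup>2 = (norm (?p - x))\<^sup>2 + 2 * ((x - ?p) \<bullet> h) + (norm h)\<^sup>2"
    by (simp add: power2_norm_eq_inner inner_simps inner_commute)
  moreover have "(inverse lam *\<^sub>R (x - ?p)) \<bullet> h = ((x - ?p) \<bullet> h) / lam"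
    by (simp add: divide_inverse mult.commute)
  ultimately show ?thesis
    using le eq assms(2) by (simp add: field_simps)
qed

section \<open>Estimates for a single step of the method\<close>

lemma ippm_step_cases:
  assumes step: "ippm_step g lam \<tau>1 \<tau>2 \<mu> \<theta> p t x \<epsilon> r x' \<epsilon>' r'" and lam: "lam > 0"
  obtains v where "norm (v - inverse lam *\<^sub>R (x - Prox lam g x)) \<le> \<epsilon>" "norm v \<le> r + \<epsilon>"
      "r' = \<mu> * r" "\<epsilon>' = \<theta> * \<epsilon>" "x' = x"
  | v where "norm (v - inverse lam *\<^sub>R (x - Prox lam g x)) \<le> \<epsilon>" "r + \<epsilon> < norm v"
      "r' = r" "\<epsilon>' = \<epsilon>" "x' = x + t *\<^sub>R (- ((norm v - \<epsilon>) / norm v) *\<^sub>R v)"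
proof -
  let ?v = "inverse lam *\<^sub>R (x - p)"
  \<comment> \<open>The error \<open>lam * \<epsilon>\<close> in the proximal point becomes an error
    \<open>\<epsilon>\<close> in the gradient of the envelope, so \<open>p\<close> can be eliminated
    in favour of \<open>v\<close>.\<close>
  have "?v - inverse lam *\<^sub>R (x - Prox lam g x) = inverse lam *\<^sub>R (Prox lam g x - p)"
    by (simp add: algebra_simps)
  then have "norm (?v - inverse lam *\<^sub>R (x - Prox lam g x)) = norm (p - Prox lam g x) / lam"
    using lam by (simp add: norm_minus_commute divide_inverse mult.commute)
  moreover have "norm (p - Prox lam g x) \<le> lam * \<epsilon>"
    using step by (simp add: ippm_step_def)
  ultimately have "norm (?v - inverse lam *\<^sub>R (x - Prox lam g x)) \<le> \<epsilon>"
    using lam by (simp add: pos_divide_le_eq mult.commute)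
  then show thesis
    using that[of ?v] step by (cases "norm ?v \<le> r + \<epsilon>") (auto simp: ippm_step_def Let_def)
qed

text \<open>With \<open>s = norm v - \<epsilon>\<close>, a step that is not null satisfies \<open>?G
  \<bullet> d \<le> - s * (s + \<epsilon>) + \<epsilon> * s = - s^2\<close>: the shortening absorbs
  the gradient error exactly. The step length \<open>t * s\<close> controls \<open>s\<close>, and
  with it the residual, through \<open>t \<ge> \<tau>1\<close>. A null step has
  \<open>x' = x\<close> and a residual controlled by its own test.\<close>

lemma ippm_step_estimates:
  fixes g :: "'a::euclidean_space \<Rightarrow> ereal"
  assumes wc: "weakly_convex \<rho> g" and lam: "lam > 0" "lam * \<rho> < 1"
    and \<tau>: "0 < \<tau>1" "\<tau>2 < 2 * lam"
    and step: "ippm_step g lam \<tau>1 \<tau>2 \<mu> \<theta> p t x \<epsilon> r x' \<epsilon>' r'" and pos: "\<epsilon> > 0" "r > 0"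
  shows "moreau_env lam g x' \<le> moreau_env lam g x - (1 / \<tau>2 - 1 / (2 * lam)) * (norm (x' - x))\<^sup>2"
    and "norm (x - Prox lam g x) \<le> lam * (norm (x' - x) / \<tau>1 + r + 2 * \<epsilon>)"
    and "(r' = \<mu> * r \<and> \<epsilon>' = \<theta> * \<epsilon>) \<or> (r' = r \<and> \<epsilon>' = \<epsilon> \<and> \<tau>1 * r \<le> norm (x' - x))"
proof -
  let ?e = "moreau_env lam g"
  let ?G = "inverse lam *\<^sub>R (x - Prox lam g x)"
  have t: "\<tau>1 \<le> t" "t \<le> \<tau>2"
    using step by (auto simp: ippm_step_def)
  have G: "norm (x - Prox lam g x) = lam * norm ?G"
    using lam(1) by simp
  have "?e x' \<le> ?e x - (1 / \<tau>2 - 1 / (2 * lam)) * (norm (x' - x))\<^sup>2 \<and>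
    norm ?G \<le> norm (x' - x) / \<tau>1 + r + 2 * \<epsilon> \<and>
    ((r' = \<mu> * r \<and> \<epsilon>' = \<theta> * \<epsilon>) \<or> (r' = r \<and> \<epsilon>' = \<epsilon> \<and> \<tau>1 * r \<le> norm (x' - x)))"
    using step lam(1)
  proof (cases rule: ippm_step_cases)
    case (1 v)
    have "norm ?G \<le> norm v + norm (v - ?G)"
      using norm_triangle_ineq4[of v "v - ?G"] by simp
    then show ?thesis
      using 1 by simp
  next
    case (2 v)
    define s where "s = norm v - \<epsilon>"
    define d where "d = - (s / norm v) *\<^sub>R v"
    have s: "r < s" "0 < s"
      using 2 pos by (auto simp: s_def)
    have nv: "norm v > 0" "norm v = s + \<epsilon>"
      using s pos by (auto simp: s_def)
    have x': "x' = x + t *\<^sub>R d"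
      using 2 by (simp add: d_def s_def)
    have nd: "norm d = s"
      using s nv by (simp add: d_def)
    have h: "norm (x' - x) = t * s"
      using x' nd t \<tau> by simp
    have "v \<bullet> d = - s * (s + \<epsilon>)"
      using nv by (simp add: d_def power2_norm_eq_inner[symmetric] power2_eq_square)
    moreover have "(?G - v) \<bullet> d \<le> \<epsilon> * s"
    proof -
      have "(?G - v) \<bullet> d \<le> norm (?G - v) * norm d"
        by (rule norm_cauchy_schwarz)
      also have "\<dots> \<le> \<epsilon> * s"
        using 2(1) nd s pos by (intro mult_mono) (auto simp: norm_minus_commute)
      finally show ?thesis .
    qed
    ultimately have Gd: "?G \<bullet> d \<le> - s\<^sup>2"
      by (simp add: inner_diff_left power2_eq_square algebra_simps)
    have "?e x' \<le> ?e x + ?G \<bullet> (t *\<^sub>R d) + (norm (t *\<^sub>R d))\<^sup>2 / (2 * lam)"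
      unfolding x' by (rule moreau_env_descent[OF wc lam])
    also have "?G \<bullet> (t *\<^sub>R d) = t * (?G \<bullet> d)"
      by simp
    also have "\<dots> \<le> t * - s\<^sup>2"
      using Gd t \<tau> by (intro mult_left_mono) auto
    \<comment> \<open>Since \<open>t \<le> \<tau>2\<close>, the decrease can be measured by the
      squared step length, with a constant independent of \<open>t\<close>.\<close>
    also have "t * - s\<^sup>2 \<le> - (t * s)\<^sup>2 / \<tau>2"
    proof -
      have "t * (t * s\<^sup>2) \<le> \<tau>2 * (t * s\<^sup>2)"
        using t \<tau> by (intro mult_right_mono) auto
      then show ?thesis
        using t \<tau> by (simp add: field_simps power2_eq_square)
    qed
    also have "norm (t *\<^sub>R d) = t * s"
      using nd t \<tau> by simp
    finally have "?e x' \<le> ?e x - (1 / \<tau>2 - 1 / (2 * lam)) * (norm (x' - x))\<^sup>2"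
      unfolding h by (simp add: algebra_simps)
    moreover have "norm ?G \<le> norm (x' - x) / \<tau>1 + r + 2 * \<epsilon>"
    proof -
      have "norm ?G \<le> norm v + norm (v - ?G)"
        using norm_triangle_ineq4[of v "v - ?G"] by simp
      then have "norm ?G \<le> s + 2 * \<epsilon>"
        using 2(1) nv by simp
      moreover have "s \<le> norm (x' - x) / \<tau>1"
        using h t \<tau> s by (simp add: field_simps)
      ultimately show ?thesis
        using pos by simp
    qed
    moreover have "\<tau>1 * r \<le> norm (x' - x)"
      unfolding h using t \<tau> s pos by (intro mult_mono) auto
    ultimately show ?thesis
      using 2 by blast
  qed
  then show "?e x' \<le> ?e x - (1 / \<tau>2 - 1 / (2 * lam)) * (norm (x' - x))\<^sup>2"
    and "norm (x - Prox lam g x) \<le> lam * (norm (x' - x) / \<tau>1 + r + 2 * \<epsilon>)"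
    and "(r' = \<mu> * r \<and> \<epsilon>' = \<theta> * \<epsilon>) \<or> (r' = r \<and> \<epsilon>' = \<epsilon> \<and> \<tau>1 * r \<le> norm (x' - x))"
    unfolding G using lam(1) by (auto intro: mult_left_mono)
qed

section \<open>Vanishing steps and convergence of the tolerances and residuals\<close>

lemma sufficient_decrease_steps_tendsto_0:
  fixes E \<delta> :: "nat \<Rightarrow> real"
  assumes dec: "\<And>k. E (Suc k) \<le> E k - c * (\<delta> k)\<^sup>2" and c: "c > 0"
    and bnd: "\<exists>\<^sub>F k in sequentially. B \<le> E k"
  shows "\<delta> \<longlonglongrightarrow> 0"
proof -
  have mono: "decseq E"
    unfolding decseq_Suc_iff
  proof
    fix k
    have "0 \<le> c * (\<delta> k)\<^sup>2" using c by simp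
    then show "E (Suc k) \<le> E k" using dec[of k] by linarith
  qed
  \<comment> \<open>Beyond every \<open>k\<close> there is an index where \<open>B\<close> is a
    lower bound, and \<open>E\<close> does not increase up to it. Hence \<open>E\<close> converges,
    and its differences dominate \<open>c\<close> times the squared steps.\<close>
  have "B \<le> E k" for k
    using bnd mono unfolding frequently_sequentially decseq_def by (meson order_trans)
  then obtain L where L: "E \<longlonglongrightarrow> L"
    using decseq_convergent[OF mono, of B] by blast
  then have "(\<lambda>k. (E k - E (Suc k)) / c) \<longlonglongrightarrow> (L - L) / c"
    using c by (intro tendsto_intros LIMSEQ_Suc) auto
  moreover have "(\<delta> k)\<^sup>2 \<le> (E k - E (Suc k)) / c" for k
    using dec[of k] c by (simp add: field_simps)
  ultimately have "(\<lambda>k. (\<delta> k)\<^sup>2) \<longlonglongrightarrow> 0"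
    by (intro Lim_null_comparison[of "\<lambda>k. (\<delta> k)\<^sup>2" "\<lambda>k. (E k - E (Suc k)) / c"]) auto
  then have "(\<lambda>k. sqrt ((\<delta> k)\<^sup>2)) \<longlonglongrightarrow> sqrt 0"
    by (rule tendsto_real_sqrt)
  then show ?thesis
    by (simp add: tendsto_rabs_zero_iff)
qed

text \<open>Indices start at 0 here; the theorem applies this to the sequences shifted by
  one.\<close>

lemma ippm_convergence:
  fixes g :: "'a::euclidean_space \<Rightarrow> ereal" and X :: "nat \<Rightarrow> 'a"
  assumes wc: "weakly_convex \<rho> g" and lam: "lam > 0" "lam * \<rho> < 1"
    and \<tau>: "0 < \<tau>1" "\<tau>1 \<le> \<tau>2" "\<tau>2 < 2 * lam" and \<mu>: "\<mu> \<in> {0<..<1}" and \<theta>: "\<theta> \<in> {0<..<1}"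
    and init: "\<epsilon> 0 > 0" "r 0 > 0"
    and step: "\<And>k. ippm_step g lam \<tau>1 \<tau>2 \<mu> \<theta> (p k) (t k)
      (X k) (\<epsilon> k) (r k) (X (Suc k)) (\<epsilon> (Suc k)) (r (Suc k))"
    and freq: "\<exists>\<^sub>F k in sequentially. norm (X k) \<le> R"
  shows "decseq \<epsilon>" "\<epsilon> \<longlonglongrightarrow> 0" "decseq r" "r \<longlonglongrightarrow> 0"
    and "(\<lambda>k. dist (X (Suc k)) (X k)) \<longlonglongrightarrow> 0"
    and "(\<lambda>k. Prox lam g (X k) - X k) \<longlonglongrightarrow> 0"
proof -
  let ?e = "moreau_env lam g"
  define \<delta> where "\<delta> k = norm (X (Suc k) - X k)" for k
  have pos: "\<epsilon> k > 0 \<and> r k > 0" for k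
  proof (induction k)
    case (Suc k)
    then show ?case
      using ippm_step_estimates(3)[OF wc lam \<tau>(1,3) step] \<mu> \<theta> by (metis greaterThanLessThan_iff mult_pos_pos)
  qed (use init in simp)
  note est = ippm_step_estimates[OF wc lam \<tau>(1,3) step]
  have alt: "(r (Suc k) = \<mu> * r k \<and> \<epsilon> (Suc k) = \<theta> * \<epsilon> k) \<or>
      (r (Suc k) = r k \<and> \<epsilon> (Suc k) = \<epsilon> k \<and> \<tau>1 * r k \<le> \<delta> k)" for k
    using est(3)[of k] pos[of k] by (simp add: \<delta>_def)
  have shrink: "\<mu> * r k \<le> r k" "\<theta> * \<epsilon> k \<le> \<epsilon> k" for k
    using pos[of k] \<mu> \<theta> by auto
  show dec: "decseq \<epsilon>" "decseq r"
    unfolding decseq_Suc_iff using alt shrink by (metis order_refl)+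
  obtain \<beta> where \<beta>: "\<And>x. norm x \<le> R \<Longrightarrow> \<beta> \<le> ?e x"
    using moreau_env_lower_bound[OF wc lam] by blast
  have \<delta>: "\<delta> \<longlonglongrightarrow> 0"
  proof (rule sufficient_decrease_steps_tendsto_0)
    show "?e (X (Suc k)) \<le> ?e (X k) - (1 / \<tau>2 - 1 / (2 * lam)) * (\<delta> k)\<^sup>2" for k
      using est(1)[of k] pos[of k] by (simp add: \<delta>_def)
    show "1 / \<tau>2 - 1 / (2 * lam) > 0"
      using \<tau> lam by (simp add: field_simps)
    show "\<exists>\<^sub>F k in sequentially. \<beta> \<le> ?e (X k)"
      using freq by (rule frequently_elim1) (rule \<beta>)
  qed
  then show "(\<lambda>k. dist (X (Suc k)) (X k)) \<longlonglongrightarrow> 0"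
    by (simp add: \<delta>_def[abs_def] dist_norm)
  \<comment> \<open>With finitely many null steps, \<open>r\<close> would stay at some
    \<open>r N > 0\<close> and all later steps would have length at least
    \<open>\<tau>1 * r N\<close>, against \<open>\<delta>\<close> tending to 0.\<close>
  have null: "\<exists>\<^sub>F k in sequentially. r (Suc k) = \<mu> * r k \<and> \<epsilon> (Suc k) = \<theta> * \<epsilon> k"
  proof (rule ccontr)
    assume "\<not> ?thesis"
    then obtain N where N: "\<And>k. k \<ge> N \<Longrightarrow> r (Suc k) = r k \<and> \<tau>1 * r k \<le> \<delta> k"
      using alt unfolding not_frequently eventually_sequentially by blast
    have r: "r k = r N" if "k \<ge> N" for k
      using that by (induction k rule: dec_induct) (use N in auto)
    have "\<tau>1 * r N \<le> 0"
    proof (rule tendsto_lowerbound[OF \<delta>])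
      show "\<forall>\<^sub>F k in sequentially. \<tau>1 * r N \<le> \<delta> k"
        unfolding eventually_sequentially
      proof (intro exI allI impI)
        fix k assume "N \<le> k"
        then show "\<tau>1 * r N \<le> \<delta> k"
          using N[of k] r[of k] by simp
      qed
    qed simp
    moreover have "\<tau>1 * r N > 0"
      using \<tau> pos[of N] by simp
    ultimately show False by simp
  qed
  show \<epsilon>0: "\<epsilon> \<longlonglongrightarrow> 0"
    by (rule frequent_contraction_tendsto_0[OF dec(1) _ \<theta>])
      (use pos in auto, use null in \<open>auto elim: frequently_elim1\<close>)
  show r0: "r \<longlonglongrightarrow> 0"
    by (rule frequent_contraction_tendsto_0[OF dec(2) _ \<mu>])
      (use pos in auto, use null in \<open>auto elim: frequently_elim1\<close>)
  have "(\<lambda>k. lam * (\<delta> k / \<tau>1 + r k + 2 * \<epsilon> k)) \<longlonglongrightarrow> lam * (0 / \<tau>1 + 0 + 2 * 0)"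
    using \<tau> by (intro tendsto_intros \<delta> r0 \<epsilon>0) auto
  then have "(\<lambda>k. lam * (\<delta> k / \<tau>1 + r k + 2 * \<epsilon> k)) \<longlonglongrightarrow> 0"
    by simp
  then show "(\<lambda>k. Prox lam g (X k) - X k) \<longlonglongrightarrow> 0"
  proof (rule Lim_null_comparison[rotated])
    have "norm (Prox lam g (X k) - X k) \<le> lam * (\<delta> k / \<tau>1 + r k + 2 * \<epsilon> k)" for k
      using est(2)[of k] pos[of k] by (simp add: \<delta>_def norm_minus_commute)
    then show "\<forall>\<^sub>F k in sequentially. norm (Prox lam g (X k) - X k) \<le> lam * (\<delta> k / \<tau>1 + r k + 2 * \<epsilon> k)"
      by simp
  qed
qed

theorem theorem3p11:
  fixes \<rho> :: real
    and g :: "real ^ 'n \<Rightarrow> ereal"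
    and x :: "nat \<Rightarrow> real ^ 'n"
    and \<epsilon> r :: "nat \<Rightarrow> real"
  assumes "\<rho> > 0"
    and "weakly_convex \<rho> g"
    and "ippm_generated \<rho> g x \<epsilon> r"
    and "\<not> filterlim (\<lambda>k. norm (x k)) at_top sequentially"
  shows "(antimono_on {1..} \<epsilon> \<and> \<epsilon> \<longlonglongrightarrow> 0 \<and> antimono_on {1..} r \<and> r \<longlonglongrightarrow> 0) \<and>
    (\<forall>a \<in> accumulation_points x. stationary_point g a) \<and>
    (bounded (x ` {1..}) \<longrightarrow>
      accumulation_points x \<noteq> {} \<and> compact (accumulation_points x) \<and>
      connected (accumulation_points x)) \<and>
    (\<forall>a. a isolated_in accumulation_points x \<longrightarrow> x \<longlonglongrightarrow> a)"
proof -
  have wc: "weakly_convex \<rho> g" by fact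
  obtain lam \<tau>1 \<tau>2 \<mu> \<theta> p t where lam: "0 < lam" "ereal lam < inverse (ereal \<rho>)"
    and \<tau>: "0 < \<tau>1" "\<tau>1 \<le> \<tau>2" "\<tau>2 < 2 * lam"
    and init: "\<epsilon> 1 > 0" "r 1 > 0" and \<mu>\<theta>: "\<mu> \<in> {0<..<1}" "\<theta> \<in> {0<..<1}"
    and step: "\<And>k. k \<ge> 1 \<Longrightarrow> ippm_step g lam \<tau>1 \<tau>2 \<mu> \<theta> (p k) (t k)
               (x k) (\<epsilon> k) (r k) (x (Suc k)) (\<epsilon> (Suc k)) (r (Suc k))"
    using assms(3) unfolding ippm_generated_def by metis
  have lam\<rho>: "lam * \<rho> < 1"
    using lam assms(1) by (simp add: field_simps)
  obtain R where "\<not> (\<forall>\<^sub>F k in sequentially. R \<le> norm (x k))"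
    using assms(4) unfolding filterlim_at_top by blast
  then have "\<not> (\<forall>\<^sub>F k in sequentially. R \<le> norm (x (Suc k)))"
    using eventually_sequentially_Suc[of "\<lambda>k. R \<le> norm (x k)"] by simp
  then have "\<exists>\<^sub>F k in sequentially. \<not> R \<le> norm (x (Suc k))"
    by (simp only: not_eventually)
  then have freq: "\<exists>\<^sub>F k in sequentially. norm (x (Suc k)) \<le> R"
    by (rule frequently_elim1) simp
  \<comment> \<open>The shift skips the arbitrary values at index 0; \<open>LIMSEQ_imp_Suc\<close>
    later carries the limits back.\<close>
  note conv = ippm_convergence[where X = "\<lambda>k. x (Suc k)" and \<epsilon> = "\<lambda>k. \<epsilon> (Suc k)" and r = "\<lambda>k. r (Suc k)"
      and p = "\<lambda>k. p (Suc k)" and t = "\<lambda>k. t (Suc k)", OF wc lam(1) lam\<rho> \<tau> \<mu>\<theta> init[unfolded One_nat_def] step freq]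
  have anti: "antimono_on {1..} u" if "decseq (\<lambda>k. u (Suc k))" for u :: "nat \<Rightarrow> real"
  proof (rule monotone_onI)
    fix m n :: nat assume "m \<in> {1..}" "n \<in> {1..}" "m \<le> n"
    then show "u n \<le> u m"
      using decseqD[OF that, of "m - 1" "n - 1"] by simp
  qed
  have "antimono_on {1..} \<epsilon>" "\<epsilon> \<longlonglongrightarrow> 0" "antimono_on {1..} r" "r \<longlonglongrightarrow> 0"
    by (rule anti[OF conv(1)] LIMSEQ_imp_Suc[OF conv(2)] anti[OF conv(3)] LIMSEQ_imp_Suc[OF conv(4)], simp)+
  moreover have steps: "(\<lambda>k. dist (x (Suc k)) (x k)) \<longlonglongrightarrow> 0"
    by (rule LIMSEQ_imp_Suc[OF conv(5)]) simp
  have prox0: "(\<lambda>k. Prox lam g (x k) - x k) \<longlonglongrightarrow> 0"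
    by (rule LIMSEQ_imp_Suc[OF conv(6)]) simp
  have "stationary_point g a" if acc: "a \<in> accumulation_points x" for a
  proof -
    obtain s where s: "strict_mono s" "(x \<circ> s) \<longlonglongrightarrow> a"
      using acc by (auto simp: accumulation_points_def)
    have "(\<lambda>k. Prox lam g (x (s k)) - x (s k)) \<longlonglongrightarrow> 0"
      using LIMSEQ_subseq_LIMSEQ[OF prox0 s(1)] by (simp add: o_def)
    \<comment> \<open>Iterates and proximal points share the limit \<open>a\<close>, so closedness
      of the graph makes \<open>a\<close> a fixed point.\<close>
    then have lim: "(\<lambda>k. Prox lam g ((x \<circ> s) k)) \<longlonglongrightarrow> a"
      using tendsto_add[OF _ s(2), of "\<lambda>k. Prox lam g (x (s k)) - x (s k)" 0] by simp
    have g: "proper_fun g" "lsc_fun g"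
      using wc by (simp_all add: weakly_convex_def)
    have mem: "Prox lam g ((x \<circ> s) k) \<in> Prox_set lam g ((x \<circ> s) k)" for k
      using Prox_set_singleton[OF wc lam(1) lam\<rho>] by blast
    note Prox_set_limit[where P = "\<lambda>k. Prox lam g ((x \<circ> s) k)", OF g mem s(2) lim]
    then show ?thesis
      by (intro prox_fixed_point_stationary[OF _ lam(1)])
  qed
  moreover have "accumulation_points x \<noteq> {} \<and> compact (accumulation_points x) \<and>
      connected (accumulation_points x)" if "bounded (x ` {1..})"
  proof -
    let ?K = "closure (x ` {1..})"
    have K: "compact ?K"
      using that by (simp add: compact_closure)
    have xK: "x k \<in> ?K" if "k \<ge> 1" for k
      using that closure_subset[of "x ` {1..}"] by auto
    then have "\<forall>\<^sub>F k in sequentially. x k \<in> ?K"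
      by (auto simp: eventually_sequentially)
    then have "accumulation_points x \<noteq> {}"
      using frequently_in_compact_accumulates[OF K eventually_frequently] by force
    moreover have "accumulation_points x \<subseteq> ?K"
    proof
      fix a assume "a \<in> accumulation_points x"
      then obtain s where s: "strict_mono s" "(x \<circ> s) \<longlonglongrightarrow> a"
        by (auto simp: accumulation_points_def)
      \<comment> \<open>Only \<open>x 0\<close> may lie outside \<open>?K\<close>, and
        \<open>s k \<ge> k\<close> keeps the tail of the subsequence away from it.\<close>
      have "\<forall>\<^sub>F k in sequentially. (x \<circ> s) k \<in> ?K"
        unfolding eventually_sequentially
      proof (intro exI allI impI)
        fix k :: nat assume "1 \<le> k"
        then show "(x \<circ> s) k \<in> ?K"
          using seq_suble[OF s(1), of k] xK[of "s k"] by simp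
      qed
      then show "a \<in> ?K"
        by (rule Lim_in_closed_set[OF closed_closure _ sequentially_bot s(2)])
    qed
    then have "bounded (accumulation_points x)"
      using K bounded_subset compact_imp_bounded by blast
    ultimately show ?thesis
      using closed_accumulation_points[of x] connected_accumulation_points[OF steps]
      by (simp add: compact_eq_bounded_closed)
  qed
  ultimately show ?thesis
    using isolated_accumulation_point_limit[OF steps] by blast
qed

end
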